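(* Let $d_1,d_2,d_3>0$ and let $A:\mathbb{R}^2\to\mathbb{R}^2$ be given by $$A(u)=\frac12\begin{pmatrix}(d_1+d_3)u_1+(d_3-d_1)(1+u_2-s(u))\\(d_2+d_3)u_2+(d_3-d_2)(1+u_1-s(u))\end{pmatrix},\qquad u=(u_1,u_2),$$ where $s(u)=\sqrt{(1+u_1+u_2)^2-4u_1u_2}$ if $u_1\ge0$ and $u_2\ge0$, and $s(u)=1+u_1+u_2$ whenever $u_1\le0$ or $u_2\le0$. Then $A$ is strictly monotone, in the sense that there exists $a_{\mathrm{lo}}>0$ such that $$\langle A(w)-A(u),w-u\rangle\ge a_{\mathrm{lo}}|w-u|^2\quad\text{for all }u,w\in\mathbb{R}^2,$$ if and only if $$(3-\sqrt8)\,d_3<d_j<(3+\sqrt8)\,d_3\quad\text{for }j=1,2.$$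
   Context: The map $A$ arises as $A(u)=\mathbb{Q}\,\mathrm{diag}(d_1,d_2,d_3)\,\Psi(u)$, where $d_1,d_2,d_3$ are the diffusion constants of three species undergoing the reaction $X_3\rightleftharpoons X_1+X_2$, $\mathbb{Q}=\begin{pmatrix}1&0&1\\0&1&1\end{pmatrix}$ and $\Psi(u)=\frac12\big(u_1-u_2-1+s(u),\ u_2-u_1-1+s(u),\ u_1+u_2+1-s(u)\big)^{\top}$. The two definitions of $s$ agree where they overlap. *)

theory Defs
  imports "HOL-Analysis.Analysis"
begin

text \<open>The two defining clauses overlap where one component of \<open>u\<close> is zero and the other is
  nonnegative; the first clause takes precedence here, and \<open>react_s_nonpos\<close> shows that the second
  clause holds on its whole region.\<close>

definition react_s :: "real^2 \<Rightarrow> real" where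
  "react_s u =
     (if u$1 \<ge> 0 \<and> u$2 \<ge> 0 then sqrt ((1 + u$1 + u$2)\<^sup>2 - 4 * u$1 * u$2)
      else 1 + u$1 + u$2)"

lemma react_s_nonneg:
  "u$1 \<ge> 0 \<Longrightarrow> u$2 \<ge> 0 \<Longrightarrow> react_s u = sqrt ((1 + u$1 + u$2)\<^sup>2 - 4 * u$1 * u$2)"
  by (simp add: react_s_def)

lemma react_s_nonpos:
  assumes "u$1 \<le> 0 \<or> u$2 \<le> 0"
  shows "react_s u = 1 + u$1 + u$2"
proof (cases "u$1 \<ge> 0 \<and> u$2 \<ge> 0")
  case True
  with assms have "u$1 = 0 \<or> u$2 = 0" by linarith
  with True show ?thesis by (auto simp: react_s_def)
next
  case False
  then show ?thesis unfolding react_s_def by argo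
qed

definition react_A :: "real \<Rightarrow> real \<Rightarrow> real \<Rightarrow> real^2 \<Rightarrow> real^2" where
  "react_A d1 d2 d3 u = (1/2) *\<^sub>R
     vector [(d1 + d3) * u$1 + (d3 - d1) * (1 + u$2 - react_s u),
             (d2 + d3) * u$2 + (d3 - d2) * (1 + u$1 - react_s u)]"

end

theory Submission
  imports Defs
begin

text \<open>The nonlinearity of \<open>A\<close> is carried by one scalar, the equilibrium amount
  \<open>q = (1 + u\<^sub>1 + u\<^sub>2 - s(u)) / 2\<close> of the species \<open>X\<^sub>3\<close>:
  the \<open>j\<close>-th component of \<open>A(u)\<close> is \<open>d\<^sub>j u\<^sub>j + (d\<^sub>3 - d\<^sub>j) q\<close>. On the nonnegative quadrant the
  amounts \<open>p\<^sub>j = u\<^sub>j - q\<close> of \<open>X\<^sub>1\<close> and \<open>X\<^sub>2\<close> are nonnegative and satisfy the mass action law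
  \<open>q = p\<^sub>1 p\<^sub>2\<close>. The product rule for finite differences turns this law into an exact formula for
  increments: with \<open>P\<^sub>1, P\<^sub>2\<close> the averages of \<open>p\<^sub>1, p\<^sub>2\<close> over the two points,
  \<open>\<Delta>q = (P\<^sub>2 \<Delta>u\<^sub>1 + P\<^sub>1 \<Delta>u\<^sub>2) / (1 + P\<^sub>1 + P\<^sub>2)\<close>. Outside the quadrant \<open>q\<close> depends only on the
  positive parts of the coordinates, and so on the whole plane
  \<open>\<Delta>q = \<alpha> \<Delta>u\<^sub>1 + \<beta> \<Delta>u\<^sub>2\<close> with \<open>(\<alpha>, \<beta>)\<close> in the triangle
  \<open>\<alpha>, \<beta> \<ge> 0, \<alpha> + \<beta> \<le> 1\<close> (\<open>react_q_increment\<close>).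

  Writing \<open>(\<xi>, \<eta>)\<close> for the increment of \<open>u\<close>, the monotonicity product is therefore
  \<open>d\<^sub>1 \<xi>\<^sup>2 + d\<^sub>2 \<eta>\<^sup>2 + (\<alpha> \<xi> + \<beta> \<eta>) ((d\<^sub>3 - d\<^sub>1) \<xi> + (d\<^sub>3 - d\<^sub>2) \<eta>)\<close>,
  which is affine in \<open>(\<alpha>, \<beta>)\<close>. It is bounded below uniformly as soon as it is positive definite at
  the three vertices of the triangle. At \<open>(0, 0)\<close> this is clear. At \<open>(1, 0)\<close> and \<open>(0, 1)\<close> it is the
  condition \<open>(d\<^sub>3 - d\<^sub>j)\<^sup>2 < 4 d\<^sub>j d\<^sub>3\<close> on the discriminant, for \<open>j = 2\<close> and \<open>j = 1\<close> respectively,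
  and this is the asserted range of \<open>d\<^sub>j / d\<^sub>3\<close>.

  Conversely, the vertices \<open>(1, 0)\<close> and \<open>(0, 1)\<close> are approached when one of the amounts
  \<open>p\<^sub>2, p\<^sub>1\<close> tends to infinity while the other tends to zero, so a monotonicity constant for \<open>A\<close>
  is a lower bound for both vertex forms.\<close>

section \<open>The equilibrium amount of the compound\<close>

definition react_q :: "real^2 \<Rightarrow> real" where
  "react_q u = (1 + u$1 + u$2 - react_s u) / 2"

lemma react_A_components:
  "react_A d1 d2 d3 u $ 1 = d1 * u$1 + (d3 - d1) * react_q u"
  "react_A d1 d2 d3 u $ 2 = d2 * u$2 + (d3 - d2) * react_q u"
  by (simp_all add: react_A_def react_q_def field_simps)

lemma inner_real_2: "(x::real^2) \<bullet> y = x$1 * y$1 + x$2 * y$2"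
  by (simp add: inner_vec_def sum_2)

lemma norm_real_2_squared: "(norm (x::real^2))\<^sup>2 = (x$1)\<^sup>2 + (x$2)\<^sup>2"
  unfolding power2_norm_eq_inner inner_real_2 by (simp add: power2_eq_square)

text \<open>The discriminant \<open>(1 + u\<^sub>1 + u\<^sub>2)\<^sup>2 - 4 u\<^sub>1 u\<^sub>2\<close> becomes the square of \<open>1 + p\<^sub>1 + p\<^sub>2\<close> in terms of
  the amounts \<open>p\<^sub>1, p\<^sub>2\<close>, which makes the square root disappear.\<close>

lemma react_q_of_amounts:
  assumes "p1 \<ge> 0" "p2 \<ge> 0"
  shows "react_q (vector [p1 + p1 * p2, p2 + p1 * p2]) = p1 * p2"
proof -
  have "(1 + (p1 + p1 * p2) + (p2 + p1 * p2))\<^sup>2 - 4 * (p1 + p1 * p2) * (p2 + p1 * p2)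
      = (1 + p1 + p2)\<^sup>2"
    by (simp add: power2_eq_square algebra_simps)
  then show ?thesis
    using assms by (simp add: react_q_def react_s_nonneg)
qed

text \<open>Truncating both coordinates at zero leaves \<open>q\<close> unchanged, so the mass action law holds on the
  whole plane for the truncated coordinates.\<close>

lemma mass_action_law:
  obtains p1 p2 where "p1 \<ge> 0" "p2 \<ge> 0" "react_q u = p1 * p2"
    "max (u$1) 0 = p1 + p1 * p2" "max (u$2) 0 = p2 + p1 * p2"
proof (cases "u$1 > 0 \<and> u$2 > 0")
  case True
  define x y s where "x = u$1" and "y = u$2" and "s = react_s u"
  have pos: "x > 0" "y > 0" using True by (auto simp: x_def y_def)
  have s_eq: "s = sqrt ((1 + x + y)\<^sup>2 - 4 * x * y)"
    using True by (simp add: s_def x_def y_def react_s_nonneg)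
  have disc: "(1 + x + y)\<^sup>2 - 4 * x * y = (1 + y - x)\<^sup>2 + 4 * x"
    "(1 + x + y)\<^sup>2 - 4 * x * y = (1 + x - y)\<^sup>2 + 4 * y"
    by (simp_all add: power2_eq_square algebra_simps)
  have s_sq: "s\<^sup>2 = (1 + x + y)\<^sup>2 - 4 * x * y"
    using pos unfolding s_eq disc(1) by simp
  have s1: "1 + y - x \<le> s"
    unfolding s_eq disc(1) using pos by (intro real_le_rsqrt) simp
  have s2: "1 + x - y \<le> s"
    unfolding s_eq disc(2) using pos by (intro real_le_rsqrt) simp
  define q where "q = (1 + x + y - s) / 2"
  have law: "q = (x - q) * (y - q)"
    using s_sq unfolding q_def by (simp add: power2_eq_square field_simps)
  have "x - q \<ge> 0" "y - q \<ge> 0"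
    using s1 s2 by (simp_all add: q_def)
  moreover have "react_q u = q"
    by (simp add: react_q_def q_def x_def y_def s_def)
  moreover have "max (u$1) 0 = x" "max (u$2) 0 = y"
    using pos by (simp_all add: x_def y_def)
  ultimately show ?thesis
    using law by (intro that[of "x - q" "y - q"]) simp_all
next
  case False
  then have "react_q u = 0"
    by (subst react_q_def, subst react_s_nonpos) auto
  with False show ?thesis
    by (intro that[of "max (u$1) 0" "max (u$2) 0"]) (auto simp: max_def)
qed

lemma max_increment:
  fixes a b c :: real
  obtains t where "0 \<le> t" "t \<le> 1" "max b c - max a c = t * (b - a)"
proof (cases "a = b")
  case True
  then show ?thesis by (intro that[of 0]) auto
next
  case False
  have "0 \<le> (max b c - max a c) / (b - a) \<and> (max b c - max a c) / (b - a) \<le> 1"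
    using False by (cases "a < b") (auto simp: max_def divide_simps)
  with False show ?thesis
    by (intro that[of "(max b c - max a c) / (b - a)"]) auto
qed

text \<open>An exact mean value formula: the increment of a product is the sum of the increments of the
  factors, each weighted by the average of the other factor. Substituting
  \<open>\<Delta>p\<^sub>j = \<Delta>u\<^sub>j - \<Delta>q\<close> and solving for \<open>\<Delta>q\<close> gives the two weights; truncation of the coordinates only
  shrinks them.\<close>

lemma react_q_increment:
  obtains \<alpha> \<beta> where "\<alpha> \<ge> 0" "\<beta> \<ge> 0" "\<alpha> + \<beta> \<le> 1"
    "react_q w - react_q u = \<alpha> * (w$1 - u$1) + \<beta> * (w$2 - u$2)"
proof -
  obtain p1 p2 where p: "p1 \<ge> 0" "p2 \<ge> 0" "react_q u = p1 * p2"
    "max (u$1) 0 = p1 + p1 * p2" "max (u$2) 0 = p2 + p1 * p2"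
    by (rule mass_action_law)
  obtain r1 r2 where r: "r1 \<ge> 0" "r2 \<ge> 0" "react_q w = r1 * r2"
    "max (w$1) 0 = r1 + r1 * r2" "max (w$2) 0 = r2 + r1 * r2"
    by (rule mass_action_law)
  obtain a where a: "0 \<le> a" "a \<le> 1" "max (w$1) 0 - max (u$1) 0 = a * (w$1 - u$1)"
    by (rule max_increment)
  obtain b where b: "0 \<le> b" "b \<le> 1" "max (w$2) 0 - max (u$2) 0 = b * (w$2 - u$2)"
    by (rule max_increment)
  define P1 P2 where "P1 = (p1 + r1) / 2" and "P2 = (p2 + r2) / 2"
  have P: "P1 \<ge> 0" "P2 \<ge> 0" using p r by (simp_all add: P1_def P2_def)
  have "(react_q w - react_q u) * (1 + P1 + P2)
      = P2 * (max (w$1) 0 - max (u$1) 0) + P1 * (max (w$2) 0 - max (u$2) 0)"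
    unfolding p r P1_def P2_def by (simp add: field_simps)
  also have "\<dots> = (P2 * a) * (w$1 - u$1) + (P1 * b) * (w$2 - u$2)"
    unfolding a b by simp
  finally have inc: "(react_q w - react_q u) * (1 + P1 + P2)
      = (P2 * a) * (w$1 - u$1) + (P1 * b) * (w$2 - u$2)" .
  have "P2 * a \<le> P2" "P1 * b \<le> P1"
    using P a b by (simp_all add: mult_left_le)
  then have "P2 * a + P1 * b \<le> 1 + P1 + P2" by simp
  then have "P2 * a / (1 + P1 + P2) + P1 * b / (1 + P1 + P2) \<le> 1"
    using P by (simp add: add_divide_distrib[symmetric])
  moreover have "react_q w - react_q u
      = P2 * a / (1 + P1 + P2) * (w$1 - u$1) + P1 * b / (1 + P1 + P2) * (w$2 - u$2)"
    using inc P by (simp add: nonzero_eq_divide_eq[symmetric] add_divide_distrib)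
  ultimately show ?thesis
    using P a b by (intro that) auto
qed

section \<open>Positive definite binary forms\<close>

lemma binary_form_pos_def:
  fixes A B C :: real
  assumes "A > 0" "C > 0" "B\<^sup>2 < 4 * A * C"
  shows "\<exists>a>0. \<forall>x y. A * x\<^sup>2 + B * x * y + C * y\<^sup>2 \<ge> a * (x\<^sup>2 + y\<^sup>2)"
proof -
  \<comment> \<open>The determinant divided by the trace is a lower bound for the smaller eigenvalue.\<close>
  define a where "a = (4 * A * C - B\<^sup>2) / (4 * (A + C))"
  have "a > 0" using assms by (simp add: a_def)
  have a_eq: "4 * a * (A + C) = 4 * A * C - B\<^sup>2"
  proof -
    have "a * (4 * (A + C)) = 4 * A * C - B\<^sup>2"
      using assms a_def by (subst nonzero_eq_divide_eq[symmetric]) auto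
    then show ?thesis by (simp add: mult_ac)
  qed
  have "a < A"
  proof -
    have "4 * a * (A + C) < 4 * A * (A + C)"
      unfolding a_eq using zero_le_power2[of B] mult_pos_pos[OF \<open>A > 0\<close> \<open>A > 0\<close>]
      unfolding distrib_left by linarith
    then show ?thesis using assms by simp
  qed
  have "A * x\<^sup>2 + B * x * y + C * y\<^sup>2 \<ge> a * (x\<^sup>2 + y\<^sup>2)" for x y
  proof -
    have "4 * (A - a) * (A * x\<^sup>2 + B * x * y + C * y\<^sup>2 - a * (x\<^sup>2 + y\<^sup>2))
        = (2 * (A - a) * x + B * y)\<^sup>2 + (4 * a\<^sup>2 + (4 * A * C - B\<^sup>2 - 4 * a * (A + C))) * y\<^sup>2"
      by (simp add: power2_eq_square algebra_simps)
    also have "\<dots> \<ge> 0" unfolding a_eq by simp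
    finally have "0 \<le> 4 * (A - a) * (A * x\<^sup>2 + B * x * y + C * y\<^sup>2 - a * (x\<^sup>2 + y\<^sup>2))" .
    then show ?thesis using \<open>a < A\<close> by (simp add: zero_le_mult_iff)
  qed
  with \<open>a > 0\<close> show ?thesis by blast
qed

lemma discriminant_condition_iff:
  fixes d e :: real
  assumes "e > 0"
  shows "(e - d)\<^sup>2 < 4 * d * e \<longleftrightarrow> (3 - sqrt 8) * e < d \<and> d < (3 + sqrt 8) * e"
proof -
  have "(e - d)\<^sup>2 < 4 * d * e \<longleftrightarrow> (d - 3 * e)\<^sup>2 < (sqrt 8 * e)\<^sup>2"
    by (simp add: power_mult_distrib) (simp add: power2_eq_square algebra_simps)
  also have "\<dots> \<longleftrightarrow> \<bar>d - 3 * e\<bar> < sqrt 8 * e"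
    using assms abs_le_square_iff[of "sqrt 8 * e" "d - 3 * e"] by (auto simp: abs_mult not_le)
  also have "\<dots> \<longleftrightarrow> (3 - sqrt 8) * e < d \<and> d < (3 + sqrt 8) * e"
    by (auto simp: abs_less_iff algebra_simps)
  finally show ?thesis .
qed

section \<open>Sufficiency\<close>

definition react_A_monotone :: "real \<Rightarrow> real \<Rightarrow> real \<Rightarrow> real \<Rightarrow> bool" where
  "react_A_monotone d1 d2 d3 a \<longleftrightarrow>
     (\<forall>u w. (react_A d1 d2 d3 w - react_A d1 d2 d3 u) \<bullet> (w - u) \<ge> a * (norm (w - u))\<^sup>2)"

text \<open>The monotonicity product is a convex combination, with weights \<open>\<alpha>\<close>, \<open>\<beta>\<close> and
  \<open>1 - \<alpha> - \<beta>\<close>, of the forms at the three vertices of the triangle.\<close>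

lemma react_A_monotone_if_discriminants:
  assumes "d1 > 0" "d2 > 0" "d3 > 0"
    and disc: "(d3 - d1)\<^sup>2 < 4 * d1 * d3" "(d3 - d2)\<^sup>2 < 4 * d2 * d3"
  shows "\<exists>a>0. react_A_monotone d1 d2 d3 a"
proof -
  obtain a1 where a1: "a1 > 0"
    "\<And>x y. d1 * x\<^sup>2 + (d3 - d1) * x * y + d3 * y\<^sup>2 \<ge> a1 * (x\<^sup>2 + y\<^sup>2)"
    using binary_form_pos_def[of d1 d3 "d3 - d1"] assms by auto
  obtain a2 where a2: "a2 > 0"
    "\<And>x y. d3 * x\<^sup>2 + (d3 - d2) * x * y + d2 * y\<^sup>2 \<ge> a2 * (x\<^sup>2 + y\<^sup>2)"
    using binary_form_pos_def[of d3 d2 "d3 - d2"] assms by (auto simp: mult.commute mult.left_commute)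
  obtain a0 where a0: "a0 > 0" "\<And>x y. d1 * x\<^sup>2 + d2 * y\<^sup>2 \<ge> a0 * (x\<^sup>2 + y\<^sup>2)"
    using binary_form_pos_def[of d1 d2 0] assms by auto
  define a where "a = min a0 (min a1 a2)"
  have "a > 0" using a0 a1 a2 by (simp add: a_def)
  have "(react_A d1 d2 d3 w - react_A d1 d2 d3 u) \<bullet> (w - u) \<ge> a * (norm (w - u))\<^sup>2" for u w
  proof -
    obtain \<alpha> \<beta> where ab: "\<alpha> \<ge> 0" "\<beta> \<ge> 0" "\<alpha> + \<beta> \<le> 1"
      and q: "react_q w - react_q u = \<alpha> * (w$1 - u$1) + \<beta> * (w$2 - u$2)"
      by (rule react_q_increment)
    define x y where "x = w$1 - u$1" and "y = w$2 - u$2"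
    define N where "N = x\<^sup>2 + y\<^sup>2"
    have "N \<ge> 0" by (simp add: N_def)
    then have "a * N \<le> a0 * N" "a * N \<le> a1 * N" "a * N \<le> a2 * N"
      by (auto simp: a_def intro!: mult_right_mono)
    then have vertex: "a * N \<le> d1 * x\<^sup>2 + d2 * y\<^sup>2"
      "a * N \<le> d1 * x\<^sup>2 + (d3 - d1) * x * y + d3 * y\<^sup>2"
      "a * N \<le> d3 * x\<^sup>2 + (d3 - d2) * x * y + d2 * y\<^sup>2"
      using a0(2)[of x y] a1(2)[of x y] a2(2)[of x y] unfolding N_def by linarith+
    have "a * N = (1 - \<alpha> - \<beta>) * (a * N) + \<beta> * (a * N) + \<alpha> * (a * N)"
      by (simp add: algebra_simps)
    also have "\<dots> \<le> (1 - \<alpha> - \<beta>) * (d1 * x\<^sup>2 + d2 * y\<^sup>2)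
        + \<beta> * (d1 * x\<^sup>2 + (d3 - d1) * x * y + d3 * y\<^sup>2)
        + \<alpha> * (d3 * x\<^sup>2 + (d3 - d2) * x * y + d2 * y\<^sup>2)"
      using ab vertex by (intro add_mono mult_left_mono) auto
    also have "\<dots> = (d1 * x + (d3 - d1) * (\<alpha> * x + \<beta> * y)) * x
        + (d2 * y + (d3 - d2) * (\<alpha> * x + \<beta> * y)) * y"
      by (simp add: power2_eq_square algebra_simps)
    also have "\<dots> = (react_A d1 d2 d3 w - react_A d1 d2 d3 u) \<bullet> (w - u)"
      unfolding x_def y_def q[symmetric]
      by (simp add: inner_real_2 react_A_components algebra_simps)
    finally show ?thesis
      by (simp add: norm_real_2_squared N_def x_def y_def)
  qed
  with \<open>a > 0\<close> show ?thesis unfolding react_A_monotone_def by blast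
qed

section \<open>Necessity\<close>

text \<open>The two base points have amounts \<open>(0, 1/h)\<close> and \<open>(h, 1/h + e)\<close>, so that \<open>\<Delta>q = 1 + e h\<close>. As
  \<open>h\<close> tends to \<open>0\<close> from the right, the increment of \<open>u\<close> tends to \<open>(1, 1 + e)\<close> and \<open>\<Delta>q\<close> tends to its
  first component: the limit of the monotonicity product is the form at the vertex \<open>(1, 0)\<close>.\<close>

lemma discriminant_if_react_A_monotone:
  assumes "d2 > 0" "a > 0" and mono: "react_A_monotone d1 d2 d3 a"
  shows "(d3 - d2)\<^sup>2 < 4 * d2 * d3"
proof -
  \<comment> \<open>The minimizer of the limiting form \<open>d\<^sub>3 + (d\<^sub>2 e + d\<^sub>3) (1 + e)\<close> over \<open>e\<close>.\<close>
  define e where "e = - (d2 + d3) / (2 * d2)"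
  define gap where "gap h = (d1 * h + d3 * (1 + e * h)) * (h + (1 + e * h))
      + (d2 * e + d3 * (1 + e * h)) * (e + (1 + e * h))
      - a * ((h + (1 + e * h))\<^sup>2 + (e + (1 + e * h))\<^sup>2)" for h
  have gap_nonneg: "gap h \<ge> 0" if h: "h > 0" "h * \<bar>e\<bar> < 1" for h
  proof -
    define p2 where "p2 = 1 / h"
    define r2 where "r2 = 1 / h + e"
    have "r2 \<ge> 0"
    proof -
      have "\<bar>e\<bar> \<le> 1 / h" using h by (simp add: field_simps)
      then show ?thesis by (simp add: r2_def)
    qed
    define u w :: "real^2"
      where "u = vector [0 + 0 * p2, p2 + 0 * p2]" and "w = vector [h + h * r2, r2 + h * r2]"
    have qu: "react_q u = 0"
      unfolding u_def using react_q_of_amounts[of 0 p2] h by (simp add: p2_def)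
    have qw: "react_q w = h * r2"
      unfolding w_def using react_q_of_amounts[of h r2] h \<open>r2 \<ge> 0\<close> by simp
    have hr: "h * r2 = 1 + e * h" using h by (simp add: r2_def field_simps)
    have inc: "(w - u) $ 1 = h + (1 + e * h)" "(w - u) $ 2 = e + (1 + e * h)"
      by (simp_all add: u_def w_def hr) (simp add: r2_def p2_def)
    have "(react_A d1 d2 d3 w - react_A d1 d2 d3 u) $ 1 = d1 * h + d3 * (1 + e * h)"
      "(react_A d1 d2 d3 w - react_A d1 d2 d3 u) $ 2 = d2 * e + d3 * (1 + e * h)"
    proof -
      have "(react_A d1 d2 d3 w - react_A d1 d2 d3 u) $ 1 = d1 * ((w - u) $ 1) + (d3 - d1) * (h * r2)"
        "(react_A d1 d2 d3 w - react_A d1 d2 d3 u) $ 2 = d2 * ((w - u) $ 2) + (d3 - d2) * (h * r2)"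
        by (simp_all add: react_A_components qu qw right_diff_distrib)
      then show "(react_A d1 d2 d3 w - react_A d1 d2 d3 u) $ 1 = d1 * h + d3 * (1 + e * h)"
        "(react_A d1 d2 d3 w - react_A d1 d2 d3 u) $ 2 = d2 * e + d3 * (1 + e * h)"
        unfolding inc hr by (simp_all add: algebra_simps)
    qed
    then have "gap h = (react_A d1 d2 d3 w - react_A d1 d2 d3 u) \<bullet> (w - u) - a * (norm (w - u))\<^sup>2"
      unfolding gap_def inner_real_2 norm_real_2_squared inc by simp
    then show ?thesis using mono by (simp add: react_A_monotone_def)
  qed
  have "((\<lambda>h. h * \<bar>e\<bar>) \<longlongrightarrow> 0 * \<bar>e\<bar>) (at_right 0)" by (intro tendsto_intros)
  then have "eventually (\<lambda>h. h * \<bar>e\<bar> < 1) (at_right (0::real))"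
    by (rule order_tendstoD) simp
  then have "eventually (\<lambda>h. 0 \<le> gap h) (at_right 0)"
    using eventually_at_right_less[of 0] by eventually_elim (rule gap_nonneg)
  moreover have "(gap \<longlongrightarrow> gap 0) (at_right 0)"
    unfolding gap_def by (intro tendsto_intros)
  ultimately have "0 \<le> gap 0"
    by (intro tendsto_lowerbound[where f = gap and F = "at_right 0"]) auto
  then have "a * (1 + (e + 1)\<^sup>2) \<le> d3 + (d2 * e + d3) * (e + 1)"
    by (simp add: gap_def)
  moreover have "0 < a * (1 + (e + 1)\<^sup>2)"
    using \<open>a > 0\<close> by (intro mult_pos_pos add_pos_nonneg) auto
  ultimately have "0 < d3 + (d2 * e + d3) * (e + 1)" by linarith
  also have "d3 + (d2 * e + d3) * (e + 1) = (4 * d2 * d3 - (d3 - d2)\<^sup>2) / (4 * d2)"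
    using \<open>d2 > 0\<close> by (simp add: e_def power2_eq_square field_simps)
  finally show ?thesis using \<open>d2 > 0\<close> by (simp add: zero_less_divide_iff)
qed

text \<open>The reaction is symmetric in \<open>X\<^sub>1\<close> and \<open>X\<^sub>2\<close>, which transfers the condition on
  \<open>d\<^sub>2\<close> to \<open>d\<^sub>1\<close>.\<close>

lemma react_A_monotone_swap:
  assumes "react_A_monotone d1 d2 d3 a"
  shows "react_A_monotone d2 d1 d3 a"
  unfolding react_A_monotone_def
proof (intro allI)
  fix u w :: "real^2"
  define swap :: "real^2 \<Rightarrow> real^2" where "swap v = vector [v$2, v$1]" for v
  have comp: "swap v $ 1 = v$2" "swap v $ 2 = v$1" for v by (simp_all add: swap_def)
  have q: "react_q (swap v) = react_q v" for v
    unfolding react_q_def react_s_def comp by (simp add: ac_simps conj_commute)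
  have "(react_A d1 d2 d3 (swap w) - react_A d1 d2 d3 (swap u)) \<bullet> (swap w - swap u)
      \<ge> a * (norm (swap w - swap u))\<^sup>2"
    using assms by (simp add: react_A_monotone_def)
  then show "(react_A d2 d1 d3 w - react_A d2 d1 d3 u) \<bullet> (w - u) \<ge> a * (norm (w - u))\<^sup>2"
    by (simp add: inner_real_2 norm_real_2_squared react_A_components comp q add.commute)
qed

section \<open>The characterization\<close>

theorem lemma5p2:
  fixes d1 d2 d3 :: real
  assumes "d1 > 0" and "d2 > 0" and "d3 > 0"
  shows "(\<exists>a_lo > 0. \<forall>u w :: real^2.
            (react_A d1 d2 d3 w - react_A d1 d2 d3 u) \<bullet> (w - u) \<ge> a_lo * (norm (w - u))\<^sup>2)
         \<longleftrightarrow>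
         ((3 - sqrt 8) * d3 < d1 \<and> d1 < (3 + sqrt 8) * d3) \<and>
         ((3 - sqrt 8) * d3 < d2 \<and> d2 < (3 + sqrt 8) * d3)"
  unfolding discriminant_condition_iff[OF \<open>d3 > 0\<close>, symmetric] react_A_monotone_def[symmetric]
  using assms react_A_monotone_if_discriminants discriminant_if_react_A_monotone
    react_A_monotone_swap
  by meson

end
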